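(* There is a countable subset $E\subset\mathbb{C}$ containing $1,q^{-2},q^{-4},\dots$ with the following property: for every $t\in\mathbb{C}\setminus E$ there is a countable union $X$ of algebraic hypersurfaces in $\mathbb{C}^{2n+1}$ such that for every $(c_0,\dots,c_n,t_0,\dots,t_{n-1})\in\mathbb{C}^{2n+1}\setminus X$ with $c_n\neq0$, the $g_t$-twisted trace $T$ on $\mathcal{A}_+$ (for the parameter $P(z)=\sum_{i=0}^nc_iz^i$) determined by $T(Z^i)=t_i$, $0\le i\le n-1$, is nondegenerate.
   Context: Let $q\in\mathbb{C}$ with $0<|q|<1$ and $n\ge2$. For $P\in\mathbb{C}[z]$ of degree $n$, $\mathcal{A}_P$ is generated by $u,v,Z,Z^{-1}$ with relations $ZZ^{-1}=Z^{-1}Z=1$, $ZuZ^{-1}=q^2u$, $ZvZ^{-1}=q^{-2}v$, $uv=P(q^{-1}Z)$, $vu=P(qZ)$, and $\mathcal{A}_+$ is its subalgebra generated by $u,v,Z$, with basis $Z^iu^j,Z^iv^j$ ($i,j\ge0$) and filtration $F_k=\operatorname{span}\{Z^iu^j,Z^iv^j: 2i+nj\le k\}$. $g_t$ is the automorphism $u\mapsto tu$, $v\mapsto t^{-1}v$, $Z\mapsto Z$. A $g_t$-twisted trace on $\mathcal{A}_+$ is a linear $T$ with $T(ab)=T(bg_t(a))$ for $a,b\in\mathcal{A}_+$; for $t\ne q^{-2k}$ ($k\ge0$) such traces are uniquely determined by the arbitrary values $T(1),\dots,T(Z^{n-1})$. $T$ is nondegenerate if for every $k\ge0$ the bilinear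 form $(a,b)\mapsto T(ab)$ on $F_k$ is nondegenerate. *)

theory Defs
  imports Complex_Main "HOL-Computational_Algebra.Polynomial" "HOL-Library.Poly_Mapping" "HOL-Library.Countable_Set"
begin

text \<open>An element of A_+ is written uniquely as a finite sum over j of f_j(Z) w_j,
  where f_j is a polynomial in Z and w_j = u^j for j >= 0, w_j = v^(-j) for j < 0.
  So an element is a function int => complex poly with finite support; the
  coefficient of the basis vector Z^i u^j (resp. Z^i v^j) is coeff (x j) i
  (resp. coeff (x (-j)) i).\<close>

type_synonym elem = "int \<Rightarrow> complex poly"

definition Aplus :: "elem set" where
  "Aplus = {x. finite {j. x j \<noteq> 0}}"

definition scl :: "complex \<Rightarrow> complex poly \<Rightarrow> complex poly" where
  "scl c p = pcompose p [:0, c:]"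

text \<open>w_a w_b = hfac a b (Z) w_(a+b), derived from uv = P(q^-1 Z), vu = P(qZ),
  u f(Z) = f(q^-2 Z) u, v f(Z) = f(q^2 Z) v.\<close>
definition hfac :: "complex \<Rightarrow> complex poly \<Rightarrow> int \<Rightarrow> int \<Rightarrow> complex poly" where
  "hfac q P a b =
     (if 0 < a \<and> b < 0 then (\<Prod>s\<in>{0..<min a (-b)}. scl (q powi (1 - 2*(a - s))) P)
      else if a < 0 \<and> 0 < b then (\<Prod>s\<in>{0..<min (-a) b}. scl (q powi (2*((-a) - s) - 1)) P)
      else 1)"

text \<open>Product: (f(Z) w_a)(g(Z) w_b) = f(Z) g(q^(-2a) Z) hfac a b (Z) w_(a+b).\<close>
definition amult :: "complex \<Rightarrow> complex poly \<Rightarrow> elem \<Rightarrow> elem \<Rightarrow> elem" where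
  "amult q P x y = (\<lambda>c. \<Sum>a\<in>{a. x a \<noteq> 0}.
      x a * scl (q powi (-2*a)) (y (c - a)) * hfac q P a (c - a))"

text \<open>The automorphism g_t: u -> t u, v -> t^-1 v, Z -> Z.\<close>
definition gt :: "complex \<Rightarrow> elem \<Rightarrow> elem" where
  "gt t x = (\<lambda>j. smult (t powi j) (x j))"

text \<open>A linear functional T on A_+ is given by its (arbitrary) values tau i j on
  the basis vectors Z^i w_j.\<close>
definition Tapp :: "(nat \<Rightarrow> int \<Rightarrow> complex) \<Rightarrow> elem \<Rightarrow> complex" where
  "Tapp \<tau> x = (\<Sum>j\<in>{j. x j \<noteq> 0}. \<Sum>i\<le>degree (x j). coeff (x j) i * \<tau> i j)"

definition is_twisted_trace ::
  "complex \<Rightarrow> complex poly \<Rightarrow> complex \<Rightarrow> (nat \<Rightarrow> int \<Rightarrow> complex) \<Rightarrow> bool" where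
  "is_twisted_trace q P t \<tau> \<longleftrightarrow>
     (\<forall>a\<in>Aplus. \<forall>b\<in>Aplus. Tapp \<tau> (amult q P a b) = Tapp \<tau> (amult q P b (gt t a)))"

definition Filt :: "nat \<Rightarrow> nat \<Rightarrow> elem set" where
  "Filt n k = {x. \<forall>j i. coeff (x j) i \<noteq> 0 \<longrightarrow> 2*i + n * nat \<bar>j\<bar> \<le> k}"

definition nondegenerate ::
  "complex \<Rightarrow> nat \<Rightarrow> complex poly \<Rightarrow> (nat \<Rightarrow> int \<Rightarrow> complex) \<Rightarrow> bool" where
  "nondegenerate q n P \<tau> \<longleftrightarrow>
     (\<forall>k. \<forall>a\<in>Filt n k. (\<forall>b\<in>Filt n k. Tapp \<tau> (amult q P a b) = 0) \<longrightarrow> a = (\<lambda>_. 0))"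

text \<open>Points of C^N are functions nat => complex (only coordinates < N matter);
  a polynomial is a finitely supported map from exponent vectors to coefficients.\<close>
type_synonym cmpoly = "((nat, nat) poly_mapping, complex) poly_mapping"

definition mpoly_eval :: "cmpoly \<Rightarrow> (nat \<Rightarrow> complex) \<Rightarrow> complex" where
  "mpoly_eval p x = (\<Sum>m\<in>Poly_Mapping.keys p. Poly_Mapping.lookup p m * (\<Prod>i\<in>Poly_Mapping.keys m. x i ^ Poly_Mapping.lookup m i))"

definition hypersurface_poly :: "nat \<Rightarrow> cmpoly \<Rightarrow> bool" where
  "hypersurface_poly N p \<longleftrightarrow> (\<forall>m\<in>Poly_Mapping.keys p. Poly_Mapping.keys m \<subseteq> {..<N}) \<and> (\<exists>m\<in>Poly_Mapping.keys p. m \<noteq> 0)"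

text \<open>Point (c_0,..,c_n,t_0,..,t_(n-1)) is x with c_i = x i, t_i = x (n+1+i).\<close>
definition param_poly :: "nat \<Rightarrow> (nat \<Rightarrow> complex) \<Rightarrow> complex poly" where
  "param_poly n x = Poly (map x [0..<n+1])"

end

theory Submission
  imports Defs "Jordan_Normal_Form.Determinant"
begin

text \<open>
  A twisted trace vanishes off the weight-zero part, and its moments tau_m = T(Z^m) are such that
  (q^-m - t q^m) tau_m satisfies the linear recurrence whose coefficients are those of P. So each
  tau_m is a polynomial in the parameters divided by a power of c_n. Pairing f(Z) w_j with
  g(Z) w_(-j) splits the form into Hankel blocks T(Z^(a+b) Q_j), where Q_j = w_j w_(-j), and the
  hypersurfaces are the zero loci of c_n times the Hankel determinants.

  To see that these determinants do not vanish identically for generic t, take P = z^n - z^(n-1)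
  and tau_m = 1/(q^-m - t q^m). Formally in t, this T is the sum over l of point masses t^l at
  q^(2l+1), that is, T(R(Z)) = R(q) + t T(R(q^2 Z)). Testing a kernel vector f with polynomial
  coefficients in t against polynomials vanishing at more and more of these points shows that t
  divides f, and by descent f = 0. Hence each determinant vanishes for finitely many t only.
\<close>

hide_const (open) Module.smult

subsection \<open>Hankel determinants\<close>

text \<open>The coefficient ring is left general because moments occur both as complex numbers and
  as polynomials in \<open>t\<close>.\<close>

definition lin_app :: "(nat \<Rightarrow> 'a) \<Rightarrow> 'a::comm_semiring_1 poly \<Rightarrow> 'a" where
  "lin_app \<tau> f = (\<Sum>i\<le>degree f. coeff f i * \<tau> i)"

text \<open>Size \<open>Suc d\<close> makes this the Gram matrix of a form on polynomials of degree
  at most \<open>d\<close>, in the basis of monomials.\<close>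

definition hankel :: "nat \<Rightarrow> (nat \<Rightarrow> 'a) \<Rightarrow> 'a mat" where
  "hankel d h = mat (Suc d) (Suc d) (\<lambda>(i, k). h (i + k))"

lemma lin_app_eq:
  assumes "degree f \<le> M"
  shows "lin_app \<tau> f = (\<Sum>i\<le>M. coeff f i * \<tau> i)"
  unfolding lin_app_def
  by (rule sum.mono_neutral_left) (use assms in \<open>auto simp: coeff_eq_0\<close>)

lemma lin_app_0 [simp]: "lin_app \<tau> 0 = 0"
  by (simp add: lin_app_def)

lemma lin_app_add: "lin_app \<tau> (f + g) = lin_app \<tau> f + lin_app \<tau> g"
proof -
  define M where "M = max (degree f) (degree g)"
  have "degree (f + g) \<le> M" "degree f \<le> M" "degree g \<le> M"
    using degree_add_le_max[of f g] by (auto simp: M_def)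
  then show ?thesis
    by (simp add: lin_app_eq[where M = M] algebra_simps sum.distrib)
qed

lemma lin_app_smult: "lin_app \<tau> (smult c f) = c * lin_app \<tau> f"
  unfolding lin_app_eq[OF degree_smult_le] lin_app_def[of \<tau> f]
  by (simp add: sum_distrib_left mult.assoc)

lemma lin_app_sum: "lin_app \<tau> (\<Sum>i\<in>A. f i) = (\<Sum>i\<in>A. lin_app \<tau> (f i))"
  by (induction A rule: infinite_finite_induct) (auto simp: lin_app_add)

lemma lin_app_monom: "lin_app \<tau> (monom c k) = c * \<tau> k"
proof -
  have "lin_app \<tau> (monom c k) = (\<Sum>i\<le>k. coeff (monom c k) i * \<tau> i)"
    by (rule lin_app_eq) (rule degree_monom_le)
  also have "\<dots> = (\<Sum>i\<le>k. if i = k then c * \<tau> k else 0)"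
    by (rule sum.cong) auto
  finally show ?thesis by simp
qed

lemma lin_app_const [simp]: "lin_app \<tau> [:c:] = c * \<tau> 0"
  by (simp add: lin_app_def)

lemma lin_app_1 [simp]: "lin_app \<tau> 1 = \<tau> 0"
  by (simp add: lin_app_def)

lemma lin_app_mult_expand:
  assumes "degree f \<le> d"
  shows "lin_app \<tau> (f * Q) = (\<Sum>k\<le>d. coeff f k * lin_app \<tau> (monom 1 k * Q))"
proof -
  have "f * Q = (\<Sum>k\<le>d. monom (coeff f k) k) * Q"
    using poly_as_sum_of_monoms'[OF assms] by simp
  also have "\<dots> = (\<Sum>k\<le>d. smult (coeff f k) (monom 1 k * Q))"
    unfolding sum_distrib_right
    by (intro sum.cong refl) (simp flip: mult_smult_left add: smult_monom)
  finally show ?thesis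
    by (simp add: lin_app_sum lin_app_smult)
qed

lemma lin_app_monom_mult:
  assumes "degree Q \<le> e"
  shows "lin_app \<tau> (monom 1 m * Q) = (\<Sum>i\<le>e. coeff Q i * \<tau> (m + i))"
  using lin_app_mult_expand[OF assms, of \<tau> "monom 1 m"]
  by (simp add: mult_monom lin_app_monom add.commute mult.commute)

lemma hankel_carrier [simp]: "hankel d h \<in> carrier_mat (Suc d) (Suc d)"
  by (simp add: hankel_def)

lemma hankel_mult_vec:
  assumes "i \<le> d" "v \<in> carrier_vec (Suc d)"
  shows "(hankel d h *\<^sub>v v) $ i = (\<Sum>k\<le>d. h (i + k) * v $ k)"
  using assms unfolding hankel_def
  by (simp add: scalar_prod_def atLeast0_lessThan_Suc_eq_insert_0 flip: atLeast0AtMost atLeastLessThanSuc_atLeastAtMost)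

text \<open>A kernel vector is read as the coefficient list of a polynomial. It has entries in the
  domain itself, not in its fraction field, so for entries that are polynomials in \<open>t\<close>
  one can ask which powers of \<open>t\<close> divide it.\<close>

lemma det_hankel_0_iff:
  fixes h :: "nat \<Rightarrow> 'a::idom"
  shows "det (hankel d h) = 0 \<longleftrightarrow>
    (\<exists>f. f \<noteq> 0 \<and> degree f \<le> d \<and> (\<forall>i\<le>d. (\<Sum>k\<le>d. h (i + k) * coeff f k) = 0))"
    (is "_ \<longleftrightarrow> ?R")
proof -
  have ker: "hankel d h *\<^sub>v v = 0\<^sub>v (Suc d) \<longleftrightarrow> (\<forall>i\<le>d. (\<Sum>k\<le>d. h (i + k) * v $ k) = 0)"
    if "v \<in> carrier_vec (Suc d)" for v
  proof -
    have "hankel d h *\<^sub>v v = 0\<^sub>v (Suc d) \<longleftrightarrow> (\<forall>i<Suc d. (hankel d h *\<^sub>v v) $ i = 0)"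
      by (auto simp: vec_eq_iff hankel_def)
    then show ?thesis
      using that by (simp add: hankel_mult_vec less_Suc_eq_le)
  qed
  show ?thesis
  proof
    assume "det (hankel d h) = 0"
    then obtain v where v: "v \<in> carrier_vec (Suc d)" "v \<noteq> 0\<^sub>v (Suc d)"
      "\<And>i. i \<le> d \<Longrightarrow> (\<Sum>k\<le>d. h (i + k) * v $ k) = 0"
      unfolding det_0_iff_vec_prod_zero[OF hankel_carrier] using ker by blast
    define f where "f = (\<Sum>k\<le>d. monom (v $ k) k)"
    have cf: "coeff f k = (if k \<le> d then v $ k else 0)" for k
      by (auto simp: f_def coeff_sum)
    from v(1,2) obtain k where "k \<le> d" "v $ k \<noteq> 0"
      by (auto simp: vec_eq_iff less_Suc_eq_le)
    then have "f \<noteq> 0" using cf[of k] by auto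
    moreover have "degree f \<le> d" by (rule degree_le) (simp add: cf)
    ultimately show ?R using v(3) by (intro exI[of _ f]) (simp add: cf)
  next
    assume ?R
    then obtain f where f: "f \<noteq> 0" "degree f \<le> d"
      "\<And>i. i \<le> d \<Longrightarrow> (\<Sum>k\<le>d. h (i + k) * coeff f k) = 0" by blast
    define v where "v = vec (Suc d) (coeff f)"
    have "v \<in> carrier_vec (Suc d)" by (simp add: v_def)
    moreover have "v $ degree f \<noteq> 0" using f by (simp add: v_def)
    then have "v \<noteq> 0\<^sub>v (Suc d)" using f(2) by auto
    moreover have "hankel d h *\<^sub>v v = 0\<^sub>v (Suc d)"
      using f(3) by (subst ker) (auto simp: v_def)
    ultimately show "det (hankel d h) = 0"
      unfolding det_0_iff_vec_prod_zero[OF hankel_carrier] by blast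
  qed
qed

text \<open>The matrix is the Gram matrix of the form sending \<open>(g, f)\<close> to
  \<open>lin_app \<tau> (g * f * Q)\<close>, so a zero determinant means that this form has a
  nonzero radical.\<close>

lemma det_hankel_lin_app_0_iff:
  fixes \<tau> :: "nat \<Rightarrow> 'a::idom"
  shows "det (hankel d (\<lambda>m. lin_app \<tau> (monom 1 m * Q))) = 0 \<longleftrightarrow>
    (\<exists>f. f \<noteq> 0 \<and> degree f \<le> d \<and> (\<forall>g. degree g \<le> d \<longrightarrow> lin_app \<tau> (g * (f * Q)) = 0))"
proof -
  have row: "(\<Sum>k\<le>d. lin_app \<tau> (monom 1 (i + k) * Q) * coeff f k) = lin_app \<tau> (monom 1 i * (f * Q))"
    if "degree f \<le> d" for f i
    using lin_app_mult_expand[OF that, of \<tau> "monom 1 i * Q"]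
    by (simp add: mult_monom mult_ac add_ac)
  have "(\<forall>i\<le>d. lin_app \<tau> (monom 1 i * R) = 0) \<longleftrightarrow> (\<forall>g. degree g \<le> d \<longrightarrow> lin_app \<tau> (g * R) = 0)"
    (is "?A \<longleftrightarrow> ?B") for R
  proof
    assume ?A
    then show ?B
      using lin_app_mult_expand[of _ d \<tau> R] by simp
  next
    assume ?B
    then show ?A
      by (simp add: degree_monom_eq)
  qed
  then show ?thesis
    unfolding det_hankel_0_iff using row by (simp cong: conj_cong)
qed

section \<open>Scaling and specialisation of Hankel determinants\<close>

lemma degree_map_poly_le:
  assumes "f 0 = 0"
  shows "degree (map_poly f p) \<le> degree p"
  by (rule degree_le) (simp add: assms coeff_map_poly coeff_eq_0)

text \<open>Only indices up to \<open>2*d\<close> occur in the matrix, and a common factor of the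
  entries preserves kernel vectors. This transfers singularity between true moments and moments
  cleared of denominators.\<close>

lemma det_hankel_0_scale:
  fixes h :: "nat \<Rightarrow> 'a::idom"
  assumes "det (hankel d h) = 0" and "\<And>m. m \<le> 2*d \<Longrightarrow> h' m = c * h m"
  shows "det (hankel d h') = 0"
proof -
  have "(\<Sum>k\<le>d. h' (i + k) * coeff f k) = c * (\<Sum>k\<le>d. h (i + k) * coeff f k)" if "i \<le> d" for f i
    unfolding sum_distrib_left using that by (intro sum.cong) (auto simp: assms(2))
  then show ?thesis
    using assms(1) unfolding det_hankel_0_iff by (metis mult_zero_right)
qed

text \<open>The Leibniz formula shows the determinant as a polynomial expression in the moments,
  which gives both evaluation at \<open>t\<close> and polynomial dependence on parameters.\<close>

lemma det_hankel_expand: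
  fixes h :: "nat \<Rightarrow> 'a::comm_ring_1"
  shows "det (hankel d h) =
    (\<Sum>p | p permutes {0..<Suc d}. signof p * (\<Prod>i = 0..<Suc d. h (i + p i)))"
  unfolding det_def'[OF hankel_carrier]
proof (intro sum.cong refl arg_cong2[where f = "(*)"] prod.cong)
  fix p i assume "p \<in> {p. p permutes {0..<Suc d}}" "i \<in> {0..<Suc d}"
  then have "i < Suc d" "p i < Suc d"
    using permutes_in_image[of p "{0..<Suc d}" i] by auto
  then show "hankel d h $$ (i, p i) = h (i + p i)"
    by (simp add: hankel_def)
qed

lemma poly_det_hankel: "poly (det (hankel d h)) t = det (hankel d (\<lambda>m. poly (h m) t))"
  for h :: "nat \<Rightarrow> 'a::comm_ring_1 poly"
proof -
  have "poly (signof p) t = signof p" for p :: "nat \<Rightarrow> nat" by (simp add: sign_def)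
  then show ?thesis
    by (simp only: det_hankel_expand poly_sum poly_mult poly_prod)
qed

lemma poly_const_map:
  "poly (map_poly (\<lambda>c. [:c:]) Q) [:z:] = [:poly Q z:]" for Q :: "'a::comm_semiring_1 poly"
  by (induction Q) (auto simp: map_poly_pCons mult.commute)

lemma prod_const_poly: "(\<Prod>i\<in>A. [:c i:]) = [:\<Prod>i\<in>A. c i:]"
  for c :: "'b \<Rightarrow> 'a::comm_semiring_1"
  by (induction A rule: infinite_finite_induct) (auto simp: one_pCons mult.commute)

lemma poly_map_poly_eval:
  "poly (map_poly (\<lambda>p. poly p 0) f) z = poly (poly f [:z:]) 0" for f :: "'a::comm_semiring_1 poly poly"
  by (induction f) (auto simp: map_poly_pCons)

section \<open>Expansion of the test functional in powers of \<open>t\<close>\<close>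

text \<open>The inner variable \<open>[:0,1:]\<close> is \<open>t\<close>. The hypothesis on
  \<open>w\<close> says that \<open>w m\<close> is \<open>den * q^m / (1 - t * q^(2*m))\<close>, and
  the conclusion is T(R(Z)) = R(q) + t T(R(q^2 Z)) multiplied by \<open>den\<close>.\<close>

lemma lin_app_shift:
  fixes R :: "'a::idom poly poly" and w :: "nat \<Rightarrow> 'a poly"
  assumes w: "\<And>m. m \<le> M \<Longrightarrow> w m = smult (q ^ m) den + [:0,1:] * smult (q ^ (2*m)) (w m)"
    and R: "degree R \<le> M"
  shows "lin_app w R = den * poly R [:q:] + [:0,1:] * lin_app w (pcompose R [:0, [:q^2:]:])"
proof -
  have dR: "degree (pcompose R [:0, [:q^2:]:]) \<le> M"
    by (rule degree_le) (use R in \<open>auto simp: coeff_pcompose_linear coeff_eq_0\<close>)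
  have pR: "poly R [:q:] = (\<Sum>i\<le>M. coeff R i * [:q:] ^ i)"
    unfolding poly_altdef
    by (rule sum.mono_neutral_left) (use R in \<open>auto simp: coeff_eq_0\<close>)
  have "coeff R i * w i = den * (coeff R i * [:q:] ^ i) +
      [:0,1:] * (coeff (pcompose R [:0, [:q^2:]:]) i * w i)" if "i \<le> M" for i
    by (subst w[OF that])
       (simp add: coeff_pcompose_linear algebra_simps poly_const_pow power_mult[symmetric] mult.commute)
  then have "(\<Sum>i\<le>M. coeff R i * w i) = (\<Sum>i\<le>M. den * (coeff R i * [:q:] ^ i) +
      [:0,1:] * (coeff (pcompose R [:0, [:q^2:]:]) i * w i))"
    by (intro sum.cong) auto
  then show ?thesis
    unfolding lin_app_eq[OF R] lin_app_eq[OF dR] pR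
    by (simp only: sum.distrib sum_distrib_left)
qed

text \<open>Substituting q^2 Z moves every point mass to the next one, so each vanishing value of
  \<open>R\<close> allows one factor \<open>t\<close> to be extracted.\<close>

lemma lin_app_shift_iterate:
  fixes R :: "'a::idom poly poly" and w :: "nat \<Rightarrow> 'a poly"
  assumes w: "\<And>m. m \<le> M \<Longrightarrow> w m = smult (q ^ m) den + [:0,1:] * smult (q ^ (2*m)) (w m)"
    and R: "degree R \<le> M"
    and zero: "\<And>l. l < L \<Longrightarrow> poly R [:q ^ (2*l+1):] = 0"
  shows "\<exists>S. lin_app w R = [:0,1:] ^ L * (den * poly R [:q ^ (2*L+1):] + [:0,1:] * S)"
  using R zero
proof (induction L arbitrary: R)
  case 0
  then show ?case using lin_app_shift[OF w, of M R] by auto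
next
  case (Suc L)
  define R' where "R' = pcompose R [:0, [:q^2:]:]"
  have ev: "poly R' [:q ^ (2*l+1):] = poly R [:q ^ (2 * Suc l + 1):]" for l
    by (simp add: R'_def poly_pcompose mult_ac power2_eq_square)
  have dR: "degree R' \<le> M" unfolding R'_def
    by (rule degree_le) (use Suc.prems in \<open>auto simp: coeff_pcompose_linear coeff_eq_0\<close>)
  have "poly R' [:q ^ (2*l+1):] = 0" if "l < L" for l
    using Suc.prems(2)[of "Suc l"] that unfolding ev by simp
  from Suc.IH[OF dR this] obtain S where
    S: "lin_app w R' = [:0,1:] ^ L * (den * poly R [:q ^ (2*Suc L+1):] + [:0,1:] * S)"
    unfolding ev by blast
  have "lin_app w R = [:0,1:] * lin_app w R'"
    using lin_app_shift[OF w Suc.prems(1)] Suc.prems(2)[of 0] by (simp add: R'_def)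
  then show ?case
    unfolding S by (intro exI[of _ S]) (simp only: power_Suc mult.assoc)
qed

lemma inj_odd_powers:
  fixes q :: complex
  assumes "0 < cmod q" "cmod q < 1"
  shows "inj (\<lambda>l. q ^ (2*l+1))"
proof (rule injI)
  fix a b :: nat
  assume "q ^ (2*a+1) = q ^ (2*b+1)"
  then have "cmod q ^ (2*a+1) = cmod q ^ (2*b+1)"
    by (metis norm_power)
  then have "2*a+1 = 2*b+1"
    using assms power_inject_exp' by (metis less_irrefl power_strict_decreasing_iff linorder_neqE_nat)
  then show "a = b" by simp
qed

text \<open>The test polynomial g kills the point masses with index from J to J+i-1,
  so the lowest-order term in t isolates the value of f at the (J+i)-th point; d+1 such values
  determine f at t = 0.\<close>
lemma kernel_divisible:
  fixes f :: "complex poly poly" and w :: "nat \<Rightarrow> complex poly"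
  assumes q: "0 < cmod q" "cmod q < 1"
    and w: "\<And>m. m \<le> 2*d + degree Q \<Longrightarrow> w m = smult (q ^ m) den + [:0,1:] * smult (q ^ (2*m)) (w m)"
    and den: "poly den 0 \<noteq> 0"
    and Q0: "\<And>l. l < J \<Longrightarrow> poly Q (q ^ (2*l+1)) = 0"
    and Q1: "\<And>l. J \<le> l \<Longrightarrow> poly Q (q ^ (2*l+1)) \<noteq> 0"
    and f: "degree f \<le> d"
    and ker: "\<And>g. degree g \<le> d \<Longrightarrow> lin_app w (g * (f * map_poly (\<lambda>c. [:c:]) Q)) = 0"
  shows "[:[:0,1:]:] dvd f"
proof -
  define f0 where "f0 = map_poly (\<lambda>p. poly p 0) f"
  let ?Q = "map_poly (\<lambda>c. [:c:]) Q"
  have dQ: "degree ?Q \<le> degree Q" by (rule degree_map_poly_le) simp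
  have root: "poly f0 (q ^ (2*(J+i)+1)) = 0" if "i \<le> d" for i
  proof -
    define g :: "complex poly poly" where "g = (\<Prod>l\<in>{J..<J+i}. [:- [:q^(2*l+1):], 1:])"
    have dg: "degree g \<le> d"
    proof -
      have "degree g \<le> (\<Sum>l\<in>{J..<J+i}. degree [:- [:q^(2*l+1):], 1::complex poly:])"
        unfolding g_def using degree_prod_sum_le[of "{J..<J+i}" "\<lambda>l. [:- [:q^(2*l+1):], 1::complex poly:]"]
        by (simp add: o_def)
      then show ?thesis using that by simp
    qed
    define R where "R = g * (f * ?Q)"
    have dR: "degree R \<le> 2*d + degree Q"
      using degree_mult_le[of g "f * ?Q"] degree_mult_le[of f ?Q] dg f dQ by (simp add: R_def)
    have gev: "poly g [:z:] = [:\<Prod>l\<in>{J..<J+i}. z - q^(2*l+1):]" for z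
    proof -
      have "poly g [:z:] = (\<Prod>l\<in>{J..<J+i}. [:z - q^(2*l+1):])"
        by (simp add: g_def poly_prod)
      also have "\<dots> = [:\<Prod>l\<in>{J..<J+i}. z - q^(2*l+1):]"
        by (rule prod_const_poly)
      finally show ?thesis .
    qed
    have z: "poly R [:q ^ (2*l+1):] = 0" if "l < J + i" for l
    proof (cases "l < J")
      case True
      then show ?thesis by (simp add: R_def poly_const_map Q0[simplified])
    next
      case False
      then have "(\<Prod>l'\<in>{J..<J+i}. q ^ (2*l+1) - q^(2*l'+1)) = 0"
        using that by (intro prod_zero) auto
      then show ?thesis by (simp only: R_def poly_mult gev) simp
    qed
    obtain S where S: "lin_app w R = [:0,1:] ^ (J+i) * (den * poly R [:q ^ (2*(J+i)+1):] + [:0,1:] * S)"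
      using lin_app_shift_iterate[OF w dR z] by blast
    moreover have "lin_app w R = 0" unfolding R_def by (rule ker[OF dg])
    ultimately have "den * poly R [:q ^ (2*(J+i)+1):] + [:0,1:] * S = 0" by simp
    \<comment> \<open>The factor \<open>t^(J+i)\<close> has been cancelled; setting
      \<open>t = 0\<close> now removes the unknown remainder \<open>S\<close>.\<close>
    then have "poly (den * poly R [:q ^ (2*(J+i)+1):] + [:0,1:] * S) 0 = 0" by simp
    then have "poly (poly R [:q ^ (2*(J+i)+1):]) 0 = 0" using den by simp
    then have "(\<Prod>l\<in>{J..<J+i}. q ^ (2*(J+i)+1) - q^(2*l+1)) * (poly f0 (q ^ (2*(J+i)+1)) * poly Q (q ^ (2*(J+i)+1))) = 0"
      unfolding R_def f0_def poly_map_poly_eval by (simp only: poly_mult gev poly_const_map) simp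
    moreover have "poly Q (q ^ (2*(J+i)+1)) \<noteq> 0" by (rule Q1) simp
    moreover have "(\<Prod>l\<in>{J..<J+i}. q ^ (2*(J+i)+1) - q^(2*l+1)) \<noteq> 0"
    proof -
      have "q ^ (2*(J+i)+1) \<noteq> q^(2*l+1)" if "l \<in> {J..<J+i}" for l
        using injD[OF inj_odd_powers[OF q], of "J+i" l] that by auto
      then show ?thesis by (subst prod_zero_iff) auto
    qed
    ultimately show ?thesis by simp
  qed
  have "f0 = 0"
  proof (rule ccontr)
    assume nz: "f0 \<noteq> 0"
    have "inj_on (\<lambda>i. q ^ (2*(J+i)+1)) {..d}"
      by (rule inj_onI) (drule injD[OF inj_odd_powers[OF q]], simp)
    then have "Suc d = card ((\<lambda>i. q ^ (2*(J+i)+1)) ` {..d})"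
      by (simp add: card_image)
    also have "\<dots> \<le> card {z. poly f0 z = 0}"
      using root by (intro card_mono poly_roots_finite nz) auto
    also have "\<dots> \<le> degree f0" by (rule card_poly_roots_bound[OF nz])
    also have "\<dots> \<le> d" using f degree_map_poly_le[of "\<lambda>p. poly p 0" f] by (simp add: f0_def)
    finally show False by simp
  qed
  then have "poly (coeff f i) 0 = 0" for i
    by (metis coeff_0 coeff_map_poly f0_def poly_0)
  then show ?thesis
    unfolding const_poly_dvd_iff by (auto simp: poly_eq_0_iff_dvd)
qed

text \<open>\<open>lin_app\<close> is linear over polynomials in \<open>t\<close>, so after dividing
  by \<open>t\<close> the quotient lies in the kernel again. Hence every power of \<open>t\<close>
  divides every coefficient of \<open>f\<close>, which is impossible for a nonzero coefficient by
  degree.\<close>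

lemma kernel_trivial:
  fixes f :: "complex poly poly" and w :: "nat \<Rightarrow> complex poly"
  assumes q: "0 < cmod q" "cmod q < 1"
    and w: "\<And>m. m \<le> 2*d + degree Q \<Longrightarrow> w m = smult (q ^ m) den + [:0,1:] * smult (q ^ (2*m)) (w m)"
    and den: "poly den 0 \<noteq> 0"
    and Q0: "\<And>l. l < J \<Longrightarrow> poly Q (q ^ (2*l+1)) = 0"
    and Q1: "\<And>l. J \<le> l \<Longrightarrow> poly Q (q ^ (2*l+1)) \<noteq> 0"
    and f: "degree f \<le> d"
    and ker: "\<And>g. degree g \<le> d \<Longrightarrow> lin_app w (g * (f * map_poly (\<lambda>c. [:c:]) Q)) = 0"
  shows "f = 0"
proof -
  have "[:[:0,1:] ^ k:] dvd f" for k
    using f ker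
  proof (induction k arbitrary: f)
    case 0
    then show ?case by (simp add: one_pCons[symmetric])
  next
    case (Suc k)
    have "[:[:0,1:]:] dvd f"
      by (rule kernel_divisible[OF q w den Q0 Q1 Suc.prems])
    then obtain f' where f': "f = [:[:0,1:]:] * f'" by (elim dvdE)
    then have f'': "f = smult [:0,1:] f'" by simp
    have "degree f' \<le> d" using Suc.prems(1) by (simp add: f'')
    moreover have "lin_app w (g * (f' * map_poly (\<lambda>c. [:c:]) Q)) = 0" if "degree g \<le> d" for g
      using Suc.prems(2)[OF that] by (simp only: f'' mult_smult_left mult_smult_right lin_app_smult) simp
    ultimately have "[:[:0,1:] ^ k:] dvd f'" by (rule Suc.IH)
    then show ?case
      unfolding f'' const_poly_dvd_iff coeff_smult power_Suc by (blast intro: mult_dvd_mono dvd_refl)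
  qed
  then have dvd: "[:0,1:] ^ k dvd coeff f i" for k i
    by (simp add: const_poly_dvd_iff)
  have "coeff f i = 0" for i
  proof (rule ccontr)
    assume "coeff f i \<noteq> 0"
    then have "degree ([:0,1::complex:] ^ Suc (degree (coeff f i))) \<le> degree (coeff f i)"
      by (rule dvd_imp_degree_le[OF dvd])
    then show False by (simp add: degree_power_eq del: power_Suc)
  qed
  then show ?thesis by (simp add: poly_eq_iff)
qed

text \<open>Only finitely many moments enter, so clearing their denominators turns the determinant
  into a polynomial \<open>D\<close> in \<open>t\<close>. It is nonzero because its kernel is
  trivial, and the exceptional \<open>t\<close> are among its roots.\<close>

lemma finite_det_hankel_zeros:
  fixes q :: complex
  assumes q: "0 < cmod q" "cmod q < 1"
    and Q0: "\<And>l. l < J \<Longrightarrow> poly Q (q ^ (2*l+1)) = 0"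
    and Q1: "\<And>l. J \<le> l \<Longrightarrow> poly Q (q ^ (2*l+1)) \<noteq> 0"
  shows "finite {t. (\<forall>m. 1 - t * q ^ (2*m) \<noteq> 0) \<and>
    det (hankel d (\<lambda>m. lin_app (\<lambda>i. q ^ i / (1 - t * q ^ (2*i))) (monom 1 m * Q))) = 0}"
    (is "finite ?S")
proof -
  define M where "M = 2*d + degree Q"
  define den where "den = (\<Prod>m\<le>M. [:1, - (q ^ (2*m)):])"
  \<comment> \<open>This is \<open>den * q^m / (1 - t * q^(2*m))\<close> with the common factor
    cancelled, for \<open>m \<le> M\<close>.\<close>
  define w where "w = (\<lambda>m. smult (q ^ m) (\<Prod>m'\<in>{..M} - {m}. [:1, - (q ^ (2*m')):]))"
  define Qc where "Qc = map_poly (\<lambda>c. [:c:]) Q"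
  define D where "D = det (hankel d (\<lambda>m. lin_app w (monom 1 m * Qc)))"
  have den_w: "smult (q ^ m) den = w m * [:1, - (q ^ (2*m)):]" if "m \<le> M" for m
    using that unfolding den_def w_def by (subst prod.remove[of _ m]) (auto simp: mult_ac)
  have weq: "w m = smult (q ^ m) den + [:0,1:] * smult (q ^ (2*m)) (w m)" if "m \<le> M" for m
    unfolding den_w[OF that] by (simp add: algebra_simps)
  have den0: "poly den 0 \<noteq> 0" by (simp add: den_def poly_prod)
  have "D \<noteq> 0"
    unfolding D_def det_hankel_lin_app_0_iff
    using kernel_trivial[OF q weq[unfolded M_def] den0 Q0 Q1] by (auto simp: Qc_def)
  have "poly D t = 0" if t: "t \<in> ?S" for t
  proof -
    let ?\<tau> = "\<lambda>i. q ^ i / (1 - t * q ^ (2*i))"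
    from t have nz: "1 - t * q ^ (2*m) \<noteq> 0" for m by blast
    have wt: "poly (w m) t = poly den t * ?\<tau> m" if "m \<le> M" for m
      using arg_cong[OF den_w[OF that], of "\<lambda>p. poly p t"] nz[of m]
      by (simp add: field_simps)
    have entry: "poly (lin_app w (monom 1 m * Qc)) t = poly den t * lin_app ?\<tau> (monom 1 m * Q)"
      if m: "m \<le> 2*d" for m
    proof -
      have dQc: "degree Qc \<le> degree Q" unfolding Qc_def by (rule degree_map_poly_le) simp
      have d1: "degree (monom 1 m * Qc) \<le> M"
        using degree_mult_le[of "monom 1 m" Qc] m dQc by (simp add: M_def degree_monom_eq)
      have d2: "degree (monom 1 m * Q) \<le> M"
        using degree_mult_le[of "monom 1 m" Q] m by (simp add: M_def degree_monom_eq)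
      have "poly (coeff (monom 1 m * Qc) i) t = coeff (monom 1 m * Q) i" for i
        by (simp add: coeff_monom_mult Qc_def coeff_map_poly)
      then show ?thesis
        unfolding lin_app_eq[OF d1] lin_app_eq[OF d2]
        by (simp add: poly_sum wt sum_distrib_left mult_ac)
    qed
    have "det (hankel d (\<lambda>m. lin_app ?\<tau> (monom 1 m * Q))) = 0"
      using t by blast
    then show ?thesis
      unfolding D_def poly_det_hankel by (rule det_hankel_0_scale) (rule entry)
  qed
  then have "?S \<subseteq> {t. poly D t = 0}" by blast
  then show ?thesis
    using finite_subset poly_roots_finite[OF \<open>D \<noteq> 0\<close>] by blast
qed

subsection \<open>Polynomial functions\<close>

definition monom_eval :: "(nat, nat) poly_mapping \<Rightarrow> (nat \<Rightarrow> complex) \<Rightarrow> complex" where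
  "monom_eval m x = (\<Prod>i\<in>Poly_Mapping.keys m. x i ^ Poly_Mapping.lookup m i)"

text \<open>Closure properties are proved for functions on parameter space; a representing
  \<open>cmpoly\<close> is chosen only when a hypersurface has to be produced.\<close>

definition poly_fun :: "nat \<Rightarrow> ((nat \<Rightarrow> complex) \<Rightarrow> complex) \<Rightarrow> bool" where
  "poly_fun N f \<longleftrightarrow> (\<exists>p. (\<forall>m\<in>Poly_Mapping.keys p. Poly_Mapping.keys m \<subseteq> {..<N}) \<and> mpoly_eval p = f)"

lemma monom_eval_superset:
  assumes "finite K" "Poly_Mapping.keys m \<subseteq> K"
  shows "monom_eval m x = (\<Prod>i\<in>K. x i ^ Poly_Mapping.lookup m i)"
  unfolding monom_eval_def
  by (rule prod.mono_neutral_left) (use assms in \<open>auto simp: in_keys_iff\<close>)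

lemma monom_eval_add: "monom_eval (m + m') x = monom_eval m x * monom_eval m' x"
proof -
  let ?K = "Poly_Mapping.keys m \<union> Poly_Mapping.keys m'"
  have "Poly_Mapping.keys (m + m') \<subseteq> ?K" by (rule keys_add)
  then show ?thesis
    by (simp add: monom_eval_superset[of ?K] lookup_add power_add prod.distrib)
qed

lemma mpoly_eval_superset:
  assumes "finite K" "Poly_Mapping.keys p \<subseteq> K"
  shows "mpoly_eval p x = (\<Sum>m\<in>K. Poly_Mapping.lookup p m * monom_eval m x)"
  unfolding mpoly_eval_def monom_eval_def[symmetric]
  by (rule sum.mono_neutral_left) (use assms in \<open>auto simp: in_keys_iff\<close>)

lemma poly_fun_monom:
  assumes "Poly_Mapping.keys m \<subseteq> {..<N}"
  shows "poly_fun N (\<lambda>x. c * monom_eval m x)"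
proof -
  have "mpoly_eval (Poly_Mapping.single m c) = (\<lambda>x. c * monom_eval m x)"
    by (rule ext) (subst mpoly_eval_superset[of "{m}"]; simp)
  then show ?thesis
    unfolding poly_fun_def by (intro exI[of _ "Poly_Mapping.single m c"]) (use assms in auto)
qed

lemma poly_fun_const: "poly_fun N (\<lambda>x. c)"
  using poly_fun_monom[of 0 N c] by (simp add: monom_eval_def)

lemma poly_fun_var:
  assumes "i < N"
  shows "poly_fun N (\<lambda>x. x i)"
  using poly_fun_monom[of "Poly_Mapping.single i 1" N 1] assms by (simp add: monom_eval_def)

lemma poly_fun_add:
  assumes "poly_fun N f" "poly_fun N g"
  shows "poly_fun N (\<lambda>x. f x + g x)"
proof -
  from assms obtain p p' where
    p: "\<And>m. m \<in> Poly_Mapping.keys p \<Longrightarrow> Poly_Mapping.keys m \<subseteq> {..<N}" "f = mpoly_eval p" and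
    p': "\<And>m. m \<in> Poly_Mapping.keys p' \<Longrightarrow> Poly_Mapping.keys m \<subseteq> {..<N}" "g = mpoly_eval p'"
    unfolding poly_fun_def by metis
  let ?K = "Poly_Mapping.keys p \<union> Poly_Mapping.keys p'"
  have sub: "Poly_Mapping.keys (p + p') \<subseteq> ?K" by (rule keys_add)
  then have "mpoly_eval (p + p') = (\<lambda>x. f x + g x)"
    by (intro ext) (simp add: p p' mpoly_eval_superset[of ?K] lookup_add algebra_simps sum.distrib)
  then show ?thesis
    unfolding poly_fun_def using p(1) p'(1) sub by (intro exI[of _ "p + p'"]) blast
qed

lemma poly_fun_sum:
  assumes "\<And>i. i \<in> A \<Longrightarrow> poly_fun N (f i)"
  shows "poly_fun N (\<lambda>x. \<Sum>i\<in>A. f i x)"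
  using assms
  by (induction A rule: infinite_finite_induct) (auto intro: poly_fun_add poly_fun_const)

lemma poly_fun_mult:
  assumes "poly_fun N f" "poly_fun N g"
  shows "poly_fun N (\<lambda>x. f x * g x)"
proof -
  from assms obtain p p' where
    p: "\<And>m. m \<in> Poly_Mapping.keys p \<Longrightarrow> Poly_Mapping.keys m \<subseteq> {..<N}" "f = mpoly_eval p" and
    p': "\<And>m. m \<in> Poly_Mapping.keys p' \<Longrightarrow> Poly_Mapping.keys m \<subseteq> {..<N}" "g = mpoly_eval p'"
    unfolding poly_fun_def by metis
  \<comment> \<open>Expanding over pairs of monomials reduces the product to sums and single
    monomials.\<close>
  have "f x * g x = (\<Sum>m\<in>Poly_Mapping.keys p. \<Sum>m'\<in>Poly_Mapping.keys p'.
      (Poly_Mapping.lookup p m * Poly_Mapping.lookup p' m') * monom_eval (m + m') x)" for x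
    unfolding p(2) p'(2) mpoly_eval_superset[OF finite_keys order_refl] sum_product monom_eval_add
    by (intro sum.cong refl) (simp only: mult_ac)
  moreover have "poly_fun N (\<lambda>x. \<Sum>m\<in>Poly_Mapping.keys p. \<Sum>m'\<in>Poly_Mapping.keys p'.
      (Poly_Mapping.lookup p m * Poly_Mapping.lookup p' m') * monom_eval (m + m') x)"
  proof (intro poly_fun_sum poly_fun_monom)
    fix m m' assume "m \<in> Poly_Mapping.keys p" "m' \<in> Poly_Mapping.keys p'"
    then show "Poly_Mapping.keys (m + m') \<subseteq> {..<N}"
      using p(1) p'(1) keys_add[of m m'] by blast
  qed
  ultimately show ?thesis by simp
qed

lemma poly_fun_prod:
  assumes "\<And>i. i \<in> A \<Longrightarrow> poly_fun N (f i)"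
  shows "poly_fun N (\<lambda>x. \<Prod>i\<in>A. f i x)"
  using assms
  by (induction A rule: infinite_finite_induct) (auto intro: poly_fun_mult poly_fun_const)

lemma poly_fun_power: "poly_fun N f \<Longrightarrow> poly_fun N (\<lambda>x. f x ^ k)"
  by (induction k) (auto intro: poly_fun_mult poly_fun_const)

lemma poly_fun_det_hankel:
  assumes "\<And>m. poly_fun N (\<lambda>x. h x m)"
  shows "poly_fun N (\<lambda>x. det (hankel d (h x)))"
  unfolding det_hankel_expand
  by (intro poly_fun_sum poly_fun_mult poly_fun_prod poly_fun_const assms)

text \<open>The extra factor x i excludes nonzero constant polynomials, which define no hypersurface.\<close>
lemma poly_fun_hypersurface:
  assumes f: "poly_fun N f" and i: "i < N" and y: "y i * f y \<noteq> 0"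
  obtains p where "hypersurface_poly N p" "\<And>x. mpoly_eval p x = x i * f x"
proof -
  have "poly_fun N (\<lambda>x. x i * f x)"
    by (intro poly_fun_mult poly_fun_var f i)
  then obtain p where p: "\<forall>m\<in>Poly_Mapping.keys p. Poly_Mapping.keys m \<subseteq> {..<N}"
    "\<And>x. mpoly_eval p x = x i * f x"
    unfolding poly_fun_def by metis
  \<comment> \<open>With \<open>0\<close> as the only possible exponent vector the polynomial would
    be constant, but it vanishes at the origin and not at \<open>y\<close>.\<close>
  have "\<exists>m\<in>Poly_Mapping.keys p. m \<noteq> 0"
  proof (rule ccontr)
    assume "\<not> ?thesis"
    then have "mpoly_eval p x = Poly_Mapping.lookup p 0" for x
      by (subst mpoly_eval_superset[of "{0}"]) (auto simp: monom_eval_def)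
    then have "mpoly_eval p y = mpoly_eval p (\<lambda>_. 0)" by simp
    then show False using y by (simp add: p(2))
  qed
  then show thesis using p that unfolding hypersurface_poly_def by blast
qed

subsection \<open>Twisted traces\<close>

lemma coeff_scl: "coeff (scl c p) i = c ^ i * coeff p i"
  by (simp add: scl_def coeff_pcompose_linear)

lemma degree_scl_le: "degree (scl c p) \<le> degree p"
  by (rule degree_le) (simp add: coeff_scl coeff_eq_0)

lemma poly_scl: "poly (scl c p) z = poly p (c * z)"
  by (simp add: scl_def poly_pcompose mult.commute)

lemma scl_0 [simp]: "scl c 0 = 0"
  and scl_1_left [simp]: "scl 1 p = p"
  and scl_const [simp]: "scl c [:b:] = [:b:]"
  and scl_monom [simp]: "scl c (monom b k) = smult (c ^ k) (monom b k)"
  and scl_smult: "scl c (smult b p) = smult b (scl c p)"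
  and scl_scl: "scl c (scl b p) = scl (c * b) p"
  by (auto simp: poly_eq_iff coeff_scl coeff_pCons power_mult_distrib split: nat.splits)

lemma scl_1_right [simp]: "scl c 1 = 1"
  using scl_const[of c 1] by (simp add: one_pCons)

lemma coeff_param_poly: "coeff (param_poly n x) i = (if i \<le> n then x i else 0)"
  by (simp add: param_poly_def nth_default_def less_Suc_eq_le del: upt_Suc)

lemma degree_param_poly_le: "degree (param_poly n x) \<le> n"
  by (rule degree_le) (simp add: coeff_param_poly)

lemma hfac_same_sign [simp]: "0 \<le> a * b \<Longrightarrow> hfac q P a b = 1"
  by (auto simp: hfac_def zero_le_mult_iff)

lemma degree_hfac_le:
  assumes "degree P \<le> n"
  shows "degree (hfac q P j (- j)) \<le> n * nat \<bar>j\<bar>"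
proof -
  have *: "degree (\<Prod>s\<in>{0..<i}. scl (c s) P) \<le> n * nat i" for c and i :: int
  proof -
    have "degree (\<Prod>s\<in>{0..<i}. scl (c s) P) \<le> (\<Sum>s\<in>{0..<i}. degree (scl (c s) P))"
      using degree_prod_sum_le[of "{0..<i}" "\<lambda>s. scl (c s) P"] by (simp add: o_def)
    also have "\<dots> \<le> (\<Sum>s\<in>{0..<i}. n)"
      by (intro sum_mono order_trans[OF degree_scl_le assms])
    finally show ?thesis by (simp add: mult.commute)
  qed
  show ?thesis
    using *[where i = j] *[where i = "- j"] by (auto simp: hfac_def)
qed

lemma poly_fun_coeff_mult:
  assumes "\<And>m. poly_fun N (\<lambda>x. coeff (F x) m)" "\<And>m. poly_fun N (\<lambda>x. coeff (F' x) m)"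
  shows "poly_fun N (\<lambda>x. coeff (F x * F' x) m)"
  unfolding coeff_mult by (intro poly_fun_sum poly_fun_mult assms)

lemma poly_fun_coeff_prod:
  assumes "\<And>i m. i \<in> A \<Longrightarrow> poly_fun N (\<lambda>x. coeff (F i x) m)"
  shows "poly_fun N (\<lambda>x. coeff (\<Prod>i\<in>A. F i x) m)"
  using assms
  by (induction A arbitrary: m rule: infinite_finite_induct)
     (auto intro: poly_fun_const poly_fun_coeff_mult)

lemma poly_fun_coeff_hfac:
  assumes "n < N"
  shows "poly_fun N (\<lambda>x. coeff (hfac q (param_poly n x) a b) m)"
proof -
  have "poly_fun N (\<lambda>x. coeff (scl c (param_poly n x)) m)" for c m
    using assms
    by (cases "m \<le> n")
       (auto simp: coeff_scl coeff_param_poly intro!: poly_fun_mult poly_fun_const poly_fun_var)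
  then have "poly_fun N (\<lambda>x. coeff (\<Prod>s\<in>{0..<i}. scl (c s) (param_poly n x)) m)" for c and i :: int
    by (intro poly_fun_coeff_prod)
  then show ?thesis
    by (cases "0 < a \<and> b < 0"; cases "a < 0 \<and> 0 < b")
       (simp_all only: hfac_def simp_thms if_True if_False poly_fun_const)
qed

section \<open>Homogeneous elements \<open>f(Z) w_j\<close> and consequences of the trace
  identity\<close>

definition sng :: "int \<Rightarrow> complex poly \<Rightarrow> elem" where
  "sng j f = (\<lambda>i. if i = j then f else 0)"

lemma finite_support_sng [simp]: "finite {i. sng j f i \<noteq> 0}"
  by (rule finite_subset[of _ "{j}"]) (auto simp: sng_def)

lemma sng_Aplus [simp]: "sng j f \<in> Aplus"
  by (simp add: Aplus_def)

lemma gt_sng: "gt t (sng j f) = sng j (smult (t powi j) f)"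
  by (auto simp: gt_def sng_def)

lemma amult_sng:
  assumes "finite {a. x a \<noteq> 0}"
  shows "amult q P x (sng b g) =
    (\<lambda>c. x (c - b) * scl (q powi (-2 * (c - b))) g * hfac q P (c - b) b)"
proof
  fix c
  have "amult q P x (sng b g) c = (\<Sum>a\<in>{a. x a \<noteq> 0}. if a = c - b
      then x (c - b) * scl (q powi (-2 * (c - b))) g * hfac q P (c - b) b else 0)"
    unfolding amult_def by (intro sum.cong) (auto simp: sng_def)
  then show "amult q P x (sng b g) c =
      x (c - b) * scl (q powi (-2 * (c - b))) g * hfac q P (c - b) b"
    using assms by (simp add: sum.delta)
qed

lemma amult_sng_sng:
  "amult q P (sng a f) (sng b g) = sng (a + b) (f * scl (q powi (-2 * a)) g * hfac q P a b)"
  unfolding amult_sng[OF finite_support_sng] by (auto simp: sng_def)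

lemma Tapp_sng: "Tapp \<tau> (sng j f) = lin_app (\<lambda>i. \<tau> i j) f"
proof -
  have "{i. sng j f i \<noteq> 0} = (if f = 0 then {} else {j})"
    by (auto simp: sng_def)
  then show ?thesis by (simp add: Tapp_def lin_app_def sng_def)
qed

lemma Tapp_eq_lin_app:
  assumes "\<And>i j. j \<noteq> 0 \<Longrightarrow> \<tau> i j = 0" "finite {j. x j \<noteq> 0}"
  shows "Tapp \<tau> x = lin_app (\<lambda>i. \<tau> i 0) (x 0)"
proof -
  have "Tapp \<tau> x = (\<Sum>j\<in>{j. x j \<noteq> 0}. if j = 0 then lin_app (\<lambda>i. \<tau> i 0) (x 0) else 0)"
    unfolding Tapp_def by (intro sum.cong) (auto simp: assms(1) lin_app_def)
  then show ?thesis using assms(2) by (auto simp: sum.delta)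
qed

lemma powi_eq_1_iff:
  fixes q :: complex
  assumes "0 < cmod q" "cmod q < 1"
  shows "q powi e = 1 \<longleftrightarrow> e = 0"
proof
  have pos: "q ^ k \<noteq> 1" if "k > 0" for k
    using assms that by (metis norm_one norm_power power_less_one_iff less_irrefl norm_ge_zero)
  assume "q powi e = 1"
  then show "e = 0"
    using pos[of "nat e"] pos[of "nat (- e)"] assms
    by (cases "e < 0"; cases "e = 0") (auto simp: power_int_def power_inverse)
qed simp

context
  fixes q t :: complex and P :: "complex poly" and \<tau> :: "nat \<Rightarrow> int \<Rightarrow> complex"
  assumes q: "0 < cmod q" "cmod q < 1" and t: "t \<noteq> 0" "t \<noteq> 1"
    and trace: "is_twisted_trace q P t \<tau>"
begin

lemma twisted_trace_sng:
  "Tapp \<tau> (amult q P (sng a f) (sng b g)) = Tapp \<tau> (amult q P (sng b g) (sng a (smult (t powi a) f)))"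
  using trace by (simp add: is_twisted_trace_def flip: gt_sng)

text \<open>Moving one \<open>Z\<close> around the trace multiplies T(Z^(m+1) w_j) by q^(-2j), which
  is not 1. For i = 0 there is no \<open>Z\<close> to move, so one generator \<open>u\<close> or
  \<open>v\<close> is moved instead, with factor \<open>t\<close> or its inverse; this is where
  \<open>t \<noteq> 1\<close> enters.\<close>

lemma twisted_trace_off_diagonal:
  assumes "j \<noteq> 0"
  shows "\<tau> i j = 0"
proof (cases i)
  case 0
  define s where "s = sgn j"
  have sign: "0 \<le> s * (j - s)" "0 \<le> (j - s) * s"
    using assms by (auto simp: s_def sgn_if)
  have "t powi s \<noteq> 1"
    using assms t by (auto simp: s_def sgn_if power_int_minus)
  moreover have "\<tau> 0 j = t powi s * \<tau> 0 j"
    using twisted_trace_sng[of s 1 "j - s" 1] sign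
    by (simp add: amult_sng_sng Tapp_sng scl_smult lin_app_smult lin_app_monom)
  ultimately show ?thesis using 0 by simp
next
  case (Suc m)
  have "q powi (-2 * j) \<noteq> 1" using powi_eq_1_iff[OF q] assms by simp
  moreover have "\<tau> (Suc m) j = q powi (-2 * j) * \<tau> (Suc m) j"
    using twisted_trace_sng[of 0 "monom 1 1" j "monom 1 m"]
    by (simp add: amult_sng_sng Tapp_sng lin_app_smult lin_app_monom mult_monom)
  ultimately show ?thesis using Suc by simp
qed

text \<open>The trace identity for a = u and b = Z^k v compares T(Z^k P(q^-1 Z)), times q^(-2k),
  with t T(Z^k P(qZ)).\<close>

lemma twisted_trace_recurrence:
  assumes "degree P \<le> n"
  shows "(\<Sum>i\<le>n. coeff P i * (inverse q ^ (k + i) - t * q ^ (k + i)) * \<tau> (k + i) 0) = 0"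
proof -
  have expand: "lin_app (\<lambda>i. \<tau> i 0) (monom 1 k * scl c P) = (\<Sum>i\<le>n. c ^ i * coeff P i * \<tau> (k + i) 0)" for c
    by (simp add: lin_app_monom_mult[OF order_trans[OF degree_scl_le assms]] coeff_scl)
  have ivl: "{0..<1::int} = {0}" by auto
  have h: "hfac q P 1 (-1) = scl (inverse q) P" "hfac q P (-1) 1 = scl q P"
    by (simp_all add: hfac_def power_int_minus ivl)
  have "(inverse q ^ 2) ^ k * (\<Sum>i\<le>n. inverse q ^ i * coeff P i * \<tau> (k + i) 0) =
      t * (\<Sum>i\<le>n. q ^ i * coeff P i * \<tau> (k + i) 0)"
    unfolding expand[symmetric] using twisted_trace_sng[of 1 1 "-1" "monom 1 k"]
    by (simp add: amult_sng_sng Tapp_sng h scl_smult lin_app_smult power_int_minus power_inverse)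
  \<comment> \<open>Multiplying by q^k balances the powers, so that the factor of each term depends
    only on \<open>k + i\<close>.\<close>
  then have "q ^ k * ((inverse q ^ 2) ^ k * (\<Sum>i\<le>n. inverse q ^ i * coeff P i * \<tau> (k + i) 0)) =
      q ^ k * (t * (\<Sum>i\<le>n. q ^ i * coeff P i * \<tau> (k + i) 0))" by simp
  moreover have "q ^ k * (inverse q ^ 2) ^ k = inverse q ^ k"
    using q by (simp add: power2_eq_square flip: power_mult_distrib mult.assoc)
  ultimately have "inverse q ^ k * (\<Sum>i\<le>n. inverse q ^ i * coeff P i * \<tau> (k + i) 0) =
      q ^ k * (t * (\<Sum>i\<le>n. q ^ i * coeff P i * \<tau> (k + i) 0))"
    by (simp flip: mult.assoc)
  then show ?thesis
    by (simp add: power_add algebra_simps sum_subtractf sum_distrib_left)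
qed

text \<open>Since T lives in weight zero, the component of \<open>a\<close> at \<open>j\<close>
  pairs only with weight \<open>-j\<close>. The filtration allows the same degrees at
  \<open>j\<close> and \<open>-j\<close>, so each block is a square Hankel form.\<close>

lemma nondegenerate_if_det_hankel:
  assumes n: "0 < n"
    and det: "\<And>d j. det (hankel d (\<lambda>m. lin_app (\<lambda>i. \<tau> i 0) (monom 1 m * hfac q P j (- j)))) \<noteq> 0"
  shows "nondegenerate q n P \<tau>"
  unfolding nondegenerate_def
proof (intro allI ballI impI)
  fix k a
  assume a: "a \<in> Filt n k" and ker: "\<forall>b\<in>Filt n k. Tapp \<tau> (amult q P a b) = 0"
  have bound: "2 * degree (a j) + n * nat \<bar>j\<bar> \<le> k" if "a j \<noteq> 0" for j
    using a that unfolding Filt_def by (metis (mono_tags, lifting) leading_coeff_0_iff mem_Collect_eq)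
  have "{j. a j \<noteq> 0} \<subseteq> {- int k..int k}"
  proof
    fix j assume "j \<in> {j. a j \<noteq> 0}"
    then have "n * nat \<bar>j\<bar> \<le> k" using bound[of j] by simp
    then have "nat \<bar>j\<bar> \<le> k" using n by (metis le_trans mult_le_mono1 mult_1 Suc_leI One_nat_def)
    then show "j \<in> {- int k..int k}" by auto
  qed
  then have fin: "finite {j. a j \<noteq> 0}" by (rule finite_subset) simp
  have "a j = 0" for j
  proof (rule ccontr)
    assume nz: "a j \<noteq> 0"
    \<comment> \<open>The largest degree of \<open>f\<close> for which \<open>f(Z) w_j\<close> lies
      in \<open>Filt n k\<close>.\<close>
    define d where "d = (k - n * nat \<bar>j\<bar>) div 2"
    have deg: "degree (a j) \<le> d" using bound[OF nz] by (simp add: d_def)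
    have "lin_app (\<lambda>i. \<tau> i 0) (g * (a j * hfac q P j (- j))) = 0" if g: "degree g \<le> d" for g
    proof -
      \<comment> \<open>The rescaling undoes the substitution caused by moving \<open>w_j\<close>
        past a polynomial in \<open>Z\<close>.\<close>
      define b where "b = sng (- j) (scl (q powi (2 * j)) g)"
      have "b \<in> Filt n k"
        unfolding Filt_def
      proof (clarify)
        fix i' i assume "coeff (b i') i \<noteq> 0"
        then have "i' = - j" "i \<le> degree g"
          by (auto simp: b_def sng_def coeff_scl le_degree split: if_splits)
        then show "2 * i + n * nat \<bar>i'\<bar> \<le> k" using g bound[OF nz] by (simp add: d_def)
      qed
      then have "Tapp \<tau> (amult q P a b) = 0" using ker by blast
      moreover have "finite {c. amult q P a b c \<noteq> 0}"
      proof (rule finite_subset)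
        show "{c. amult q P a b c \<noteq> 0} \<subseteq> (\<lambda>c. c - j) ` {c. a c \<noteq> 0}"
        proof
          fix c assume "c \<in> {c. amult q P a b c \<noteq> 0}"
          then have "a (c + j) \<noteq> 0" by (auto simp: b_def amult_sng[OF fin])
          then show "c \<in> (\<lambda>c. c - j) ` {c. a c \<noteq> 0}" by (intro image_eqI[of _ _ "c + j"]) auto
        qed
      qed (use fin in simp)
      ultimately have "lin_app (\<lambda>i. \<tau> i 0) (amult q P a b 0) = 0"
        using Tapp_eq_lin_app[OF twisted_trace_off_diagonal] by simp
      moreover have "amult q P a b 0 = a j * g * hfac q P j (- j)"
        using q by (simp add: b_def amult_sng[OF fin] scl_scl power_int_minus)
      ultimately show ?thesis by (simp add: mult_ac)
    qed
    then have "det (hankel d (\<lambda>m. lin_app (\<lambda>i. \<tau> i 0) (monom 1 m * hfac q P j (- j)))) = 0"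
      unfolding det_hankel_lin_app_0_iff using nz deg by blast
    then show False using det by blast
  qed
  then show "a = (\<lambda>_. 0)" by blast
qed

end

text \<open>The m-th moment cleared of denominators, i.e. multiplied by x n ^ m; s m stands for
  q^-m - t q^m.\<close>
function moment :: "(nat \<Rightarrow> complex) \<Rightarrow> nat \<Rightarrow> nat \<Rightarrow> (nat \<Rightarrow> complex) \<Rightarrow> complex" where
  "moment s n m x = (if m < n then x (n + 1 + m) * x n ^ m
     else - (1 / s m) * (\<Sum>i<n. x i * s (m - n + i) * x n ^ (n - 1 - i) * moment s n (m - n + i) x))"
  by pat_completeness auto
termination by (relation "measure (\<lambda>(s, n, m, x). m)") auto

declare moment.simps [simp del]

lemma poly_fun_moment: "poly_fun (2 * n + 1) (moment s n m)"
proof (induction m rule: less_induct)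
  case (less m)
  show ?case
  proof (cases "m < n")
    case True
    have "moment s n m = (\<lambda>x. x (n + 1 + m) * x n ^ m)"
      using True by (intro ext) (subst moment.simps, simp)
    then show ?thesis using True
      by (auto intro!: poly_fun_mult poly_fun_power poly_fun_var)
  next
    case False
    have "moment s n m = (\<lambda>x. - (1 / s m) *
        (\<Sum>i<n. x i * s (m - n + i) * x n ^ (n - 1 - i) * moment s n (m - n + i) x))"
      using False by (intro ext) (subst moment.simps, simp)
    moreover have "poly_fun (2 * n + 1) (\<lambda>x. - (1 / s m) *
        (\<Sum>i<n. x i * s (m - n + i) * x n ^ (n - 1 - i) * moment s n (m - n + i) x))"
      using False
      by (intro poly_fun_mult poly_fun_sum poly_fun_const poly_fun_power poly_fun_var less) auto
    ultimately show ?thesis by simp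
  qed
qed

text \<open>The recurrence is solved for its top term. The exponents \<open>n - 1 - i\<close> and
  \<open>m - n + i\<close> add up to \<open>m - 1\<close>, and the last factor \<open>x n\<close>
  comes from the leading coefficient.\<close>

lemma moment_eq:
  assumes s: "\<And>m. s m \<noteq> 0" and x: "x n \<noteq> 0"
    and init: "\<And>i. i < n \<Longrightarrow> \<tau> i = x (n + 1 + i)"
    and rec: "\<And>k. (\<Sum>i\<le>n. x i * s (k + i) * \<tau> (k + i)) = 0"
  shows "moment s n m x = x n ^ m * \<tau> m"
proof (induction m rule: less_induct)
  case (less m)
  show ?case
  proof (cases "m < n")
    case True
    then show ?thesis by (subst moment.simps) (simp add: init)
  next
    case False
    have "(\<Sum>i<n. x i * s (m - n + i) * x n ^ (n - 1 - i) * moment s n (m - n + i) x) =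
        (\<Sum>i<n. x n ^ (m - 1) * (x i * s (m - n + i) * \<tau> (m - n + i)))"
    proof (intro sum.cong refl)
      fix i assume "i \<in> {..<n}"
      then have "m - n + i < m" and e: "m - 1 = (n - 1 - i) + (m - n + i)" using False by auto
      then show "x i * s (m - n + i) * x n ^ (n - 1 - i) * moment s n (m - n + i) x =
          x n ^ (m - 1) * (x i * s (m - n + i) * \<tau> (m - n + i))"
        by (simp only: less e power_add) (simp add: mult_ac)
    qed
    also have "\<dots> = x n ^ (m - 1) * (\<Sum>i<n. x i * s (m - n + i) * \<tau> (m - n + i))"
      by (simp add: sum_distrib_left)
    also have "(\<Sum>i<n. x i * s (m - n + i) * \<tau> (m - n + i)) = - (x n * s m * \<tau> m)"
      using rec[of "m - n"] False by (simp add: lessThan_Suc_atMost[symmetric] add_eq_0_iff2)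
    finally have S: "(\<Sum>i<n. x i * s (m - n + i) * x n ^ (n - 1 - i) * moment s n (m - n + i) x) =
        - (x n * x n ^ (m - 1)) * s m * \<tau> m" by (simp add: mult_ac)
    show ?thesis
    proof (cases "m = 0")
      \<comment> \<open>Truncated subtraction in \<open>m - 1\<close> makes this case separate:
        \<open>n = 0\<close>, and the recurrence forces \<open>\<tau> m = 0\<close>.\<close>
      case True
      then have "n = 0" using False by simp
      then show ?thesis using rec[of m] s[of m] x True by (subst moment.simps) simp
    next
      case nz: False
      have "x n * x n ^ (m - 1) = x n ^ m"
        using nz by (metis Suc_pred' bot_nat_0.not_eq_extremum power_Suc)
      then show ?thesis using False s[of m]
        by (subst moment.simps, subst S) simp
    qed
  qed
qed

subsection \<open>Generic nondegeneracy\<close>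

text \<open>P = z^n - z^(n-1), whose recurrence has the constant solution s m * tau m = 1.\<close>
definition test_point :: "nat \<Rightarrow> (nat \<Rightarrow> complex) \<Rightarrow> nat \<Rightarrow> complex" where
  "test_point n s i =
     (if i < n - 1 then 0 else if i = n - 1 then - 1 else if i = n then 1 else 1 / s (i - (n + 1)))"

lemma test_point_top: "0 < n \<Longrightarrow> test_point n s n = 1"
  by (cases n) (simp_all add: test_point_def)

text \<open>The coefficients of z^n - z^(n-1) sum to zero, so \<open>1 / s m\<close> solves the
  recurrence. The leading coefficient is 1, so the clearing factor is trivial.\<close>

lemma moment_test_point:
  assumes "\<And>m. s m \<noteq> 0" "0 < n"
  shows "moment s n m (test_point n s) = 1 / s m"
proof -
  have "(\<Sum>i\<le>n. test_point n s i) = (\<Sum>i\<in>{n - 1, n}. test_point n s i)"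
    by (rule sum.mono_neutral_right) (auto simp: test_point_def)
  also have "\<dots> = 0" using assms(2) by (cases n) (simp_all add: test_point_def)
  finally have "(\<Sum>i\<le>n. test_point n s i * s (k + i) * (1 / s (k + i))) = 0" for k
    using assms(1) by simp
  then have "moment s n m (test_point n s) = test_point n s n ^ m * (1 / s m)"
    using assms by (intro moment_eq) (auto simp: test_point_def)
  then show ?thesis using assms(2) by (simp add: test_point_top)
qed

lemma param_poly_test_point:
  assumes "0 < n"
  shows "param_poly n (test_point n s) = monom 1 n - monom 1 (n - 1)"
  using assms by (auto simp: poly_eq_iff coeff_param_poly test_point_def)

text \<open>At the point q^(2l+1) the factors of \<open>hfac q P j (- j)\<close> become values of
  \<open>P\<close> at even powers of \<open>q\<close>. For j > 0 the exponent 0 occurs exactly when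
  l < j; for j < 0 all exponents are positive. So exactly the first \<open>nat j\<close> point
  masses are killed.\<close>

lemma poly_hfac_zero_iff:
  fixes q :: complex
  assumes q: "q \<noteq> 0" and P: "\<And>e. poly P (q powi e) = 0 \<longleftrightarrow> e = 0"
  shows "poly (hfac q P j (- j)) (q ^ (2*l+1)) = 0 \<longleftrightarrow> l < nat j"
proof -
  have shift: "q powi e * q ^ (2*l+1) = q powi (e + (2 * int l + 1))" for e
  proof -
    have "q ^ (2*l+1) = q powi (2 * int l + 1)"
      unfolding power_int_of_nat[symmetric] by (simp add: add.commute)
    then show ?thesis using q by (simp only: power_int_add simp_thms)
  qed
  have prod: "poly (\<Prod>s\<in>{0..<i}. scl (q powi (c s)) P) (q ^ (2*l+1)) = 0 \<longleftrightarrow>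
      (\<exists>s\<in>{0..<i}. c s + (2 * int l + 1) = 0)" for c and i :: int
    unfolding poly_prod poly_scl shift by (simp add: P)
  consider "0 < j" | "j = 0" | "j < 0" by linarith
  then show ?thesis
  proof cases
    case 1
    have "(\<exists>s\<in>{0..<j}. 1 - 2 * (j - s) + (2 * int l + 1) = 0) \<longleftrightarrow> l < nat j"
    proof
      assume "l < nat j"
      then show "\<exists>s\<in>{0..<j}. 1 - 2 * (j - s) + (2 * int l + 1) = 0"
        by (intro bexI[of _ "j - int l - 1"]) auto
    qed auto
    moreover have "hfac q P j (- j) = (\<Prod>s\<in>{0..<j}. scl (q powi (1 - 2 * (j - s))) P)"
      using 1 by (simp add: hfac_def)
    ultimately show ?thesis by (simp only: prod)
  next
    case 2
    then show ?thesis by simp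
  next
    case 3
    have "\<not> (\<exists>s\<in>{0..<- j}. 2 * (- j - s) - 1 + (2 * int l + 1) = 0)" by auto
    moreover have "hfac q P j (- j) = (\<Prod>s\<in>{0..<- j}. scl (q powi (2 * (- j - s) - 1)) P)"
      using 3 by (simp add: hfac_def)
    moreover have "\<not> l < nat j" using 3 by simp
    ultimately show ?thesis by (simp only: prod)
  qed
qed

theorem theorem5p6:
  fixes q :: complex and n :: nat
  assumes "0 < cmod q" and "cmod q < 1" and "2 \<le> n"
  shows "\<exists>E :: complex set. countable E \<and> (\<forall>k::nat. q powi (-2 * int k) \<in> E) \<and>
    (\<forall>t. t \<notin> E \<longrightarrow>
      (\<exists>Hs :: cmpoly set. countable Hs \<and> (\<forall>p\<in>Hs. hypersurface_poly (2*n+1) p) \<and>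
        (\<forall>x :: nat \<Rightarrow> complex. (\<forall>p\<in>Hs. mpoly_eval p x \<noteq> 0) \<and> x n \<noteq> 0 \<longrightarrow>
          (\<forall>\<tau>. is_twisted_trace q (param_poly n x) t \<tau> \<and> (\<forall>i<n. \<tau> i 0 = x (n+1+i))
               \<longrightarrow> nondegenerate q n (param_poly n x) \<tau>))))"
proof -
  have q0: "q \<noteq> 0" and n: "0 < n" using assms by auto
  define P0 :: "complex poly" where "P0 = monom 1 n - monom 1 (n - 1)"
  have "poly P0 z = z ^ (n - 1) * (z - 1)" for z
    using n by (cases n) (simp_all add: P0_def poly_monom algebra_simps)
  then have "poly P0 (q powi e) = 0 \<longleftrightarrow> e = 0" for e
    using q0 powi_eq_1_iff[OF assms(1,2), of e] by auto
  note Q_zero = poly_hfac_zero_iff[OF q0 this]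
  define bad where "bad d j = {t. (\<forall>m. 1 - t * q ^ (2*m) \<noteq> 0) \<and>
    det (hankel d (\<lambda>m. lin_app (\<lambda>i. q ^ i / (1 - t * q ^ (2*i))) (monom 1 m * hfac q P0 j (- j)))) = 0}"
    for d j
  have "finite (bad d j)" for d j
    unfolding bad_def
    by (rule finite_det_hankel_zeros[OF assms(1,2), of "nat j"]; subst Q_zero; simp)
  \<comment> \<open>The powers of \<open>q\<close> are the poles of the test moments and include 1;
    together with 0 they secure the assumptions on \<open>t\<close> made for twisted traces.\<close>
  define E where "E = {0} \<union> range (\<lambda>k::nat. q powi (-2 * int k)) \<union> (\<Union>d. \<Union>j. bad d j)"
  have "countable E"
    unfolding E_def using \<open>\<And>d j. finite (bad d j)\<close> by (intro countable_Un countable_UN) (auto intro: countable_finite)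
  moreover have "q powi (-2 * int k) \<in> E" for k :: nat unfolding E_def by blast
  moreover have "\<exists>Hs :: cmpoly set. countable Hs \<and> (\<forall>p\<in>Hs. hypersurface_poly (2*n+1) p) \<and>
        (\<forall>x :: nat \<Rightarrow> complex. (\<forall>p\<in>Hs. mpoly_eval p x \<noteq> 0) \<and> x n \<noteq> 0 \<longrightarrow>
          (\<forall>\<tau>. is_twisted_trace q (param_poly n x) t \<tau> \<and> (\<forall>i<n. \<tau> i 0 = x (n+1+i))
               \<longrightarrow> nondegenerate q n (param_poly n x) \<tau>))" if t: "t \<notin> E" for t
  proof -
    define s where "s m = inverse q ^ m - t * q ^ m" for m
    have tq: "1 - t * q ^ (2*m) \<noteq> 0" for m
    proof
      assume "1 - t * q ^ (2*m) = 0"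
      then have "t = inverse (q ^ (2*m))" using q0 by (simp add: field_simps)
      also have "\<dots> = q powi (-2 * int m)"
        by (simp add: power_int_minus flip: power_int_of_nat)
      finally show False using t unfolding E_def by blast
    qed
    have s_inv: "1 / s m = q ^ m / (1 - t * q ^ (2*m))" for m
      using q0 by (simp add: s_def field_simps power_mult power2_eq_square flip: power_add)
    have s0: "s m \<noteq> 0" for m
      using s_inv[of m] tq[of m] q0 by auto
    have t01: "t \<noteq> 0" "t \<noteq> 1" using t tq[of 0] by (auto simp: E_def)
    \<comment> \<open>The highest moment index in the block: \<open>2 * d\<close> from the two
      polynomials plus the degree bound of \<open>hfac\<close>.\<close>
    define N where "N d j = 2 * d + n * nat \<bar>j\<bar>" for d j
    \<comment> \<open>Multiplying by \<open>x n ^ N d j\<close> clears all denominators at once, so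
      these entries are polynomial in \<open>x\<close>.\<close>
    define h where "h d j x m = (\<Sum>i\<le>n * nat \<bar>j\<bar>. coeff (hfac q (param_poly n x) j (- j)) i *
      (x n ^ (N d j - (m + i)) * moment s n (m + i) x))" for d j x m
    have scale: "h d j x m = x n ^ N d j * lin_app \<tau> (monom 1 m * hfac q (param_poly n x) j (- j))"
      if "\<And>m. moment s n m x = x n ^ m * \<tau> m" "m \<le> 2 * d" for d j x \<tau> m
    proof -
      have "x n ^ (N d j - (m + i)) * x n ^ (m + i) = x n ^ N d j" if "i \<le> n * nat \<bar>j\<bar>" for i
        using that \<open>m \<le> 2 * d\<close> by (simp add: N_def flip: power_add)
      then show ?thesis
        unfolding h_def lin_app_monom_mult[OF degree_hfac_le[OF degree_param_poly_le]] that(1) sum_distrib_left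
        by (intro sum.cong refl) (simp add: algebra_simps)
    qed
    have poly: "poly_fun (2*n+1) (\<lambda>x. det (hankel d (h d j x)))" for d j
      unfolding h_def
      by (intro poly_fun_det_hankel poly_fun_sum poly_fun_mult poly_fun_power poly_fun_var
          poly_fun_moment poly_fun_coeff_hfac) auto
    \<comment> \<open>At the test point the determinant is the one whose zeros in \<open>t\<close>
      form \<open>bad d j\<close>, a set contained in \<open>E\<close>.\<close>
    have nonzero: "test_point n s n * det (hankel d (h d j (test_point n s))) \<noteq> 0" for d j
    proof
      let ?y = "test_point n s"
      assume "?y n * det (hankel d (h d j ?y)) = 0"
      then have "det (hankel d (h d j ?y)) = 0" using n by (simp add: test_point_top)
      then have "det (hankel d (\<lambda>m. lin_app (\<lambda>i. 1 / s i) (monom 1 m * hfac q (param_poly n ?y) j (- j)))) = 0"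
        by (rule det_hankel_0_scale[where c = 1])
           (use scale[of ?y "\<lambda>i. 1 / s i"] moment_test_point[OF s0 n] n in \<open>simp add: test_point_top\<close>)
      then have "t \<in> bad d j"
        using tq by (simp add: bad_def s_inv param_poly_test_point[OF n] P0_def)
      then show False using t by (auto simp: E_def)
    qed
    have "\<exists>p. hypersurface_poly (2*n+1) p \<and>
        (\<forall>x. mpoly_eval p x = x n * det (hankel d (h d j x)))" for d j
      using poly_fun_hypersurface[OF poly _ nonzero, of d j] by auto
    then obtain p where p: "\<And>d j. hypersurface_poly (2*n+1) (p d j)"
      "\<And>d j x. mpoly_eval (p d j) x = x n * det (hankel d (h d j x))"
      by metis
    show ?thesis
    proof (intro exI conjI allI impI)
      \<comment> \<open>One hypersurface for each block size \<open>d\<close> and weight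
        \<open>j\<close>.\<close>
      show "countable (range (\<lambda>(d, j). p d j))" by simp
      show "\<forall>p\<in>range (\<lambda>(d, j). p d j). hypersurface_poly (2*n+1) p" using p(1) by auto
      fix x \<tau>
      assume x: "(\<forall>p\<in>range (\<lambda>(d, j). p d j). mpoly_eval p x \<noteq> 0) \<and> x n \<noteq> 0"
        and \<tau>: "is_twisted_trace q (param_poly n x) t \<tau> \<and> (\<forall>i<n. \<tau> i 0 = x (n+1+i))"
      have nz: "det (hankel d (h d j x)) \<noteq> 0" for d j
        using x p(2)[of d j x] by force
      note trace = assms(1,2) t01 conjunct1[OF \<tau>]
      have "(\<Sum>i\<le>n. x i * s (k + i) * \<tau> (k + i) 0) = 0" for k
        using twisted_trace_recurrence[OF trace degree_param_poly_le, of k]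
        by (simp add: coeff_param_poly s_def cong: sum.cong_simp)
      then have moment: "moment s n m x = x n ^ m * \<tau> m 0" for m
        using x \<tau> s0 by (intro moment_eq) auto
      show "nondegenerate q n (param_poly n x) \<tau>"
      proof (rule nondegenerate_if_det_hankel[OF trace n])
        fix d j
        show "det (hankel d (\<lambda>m. lin_app (\<lambda>i. \<tau> i 0)
            (monom 1 m * hfac q (param_poly n x) j (- j)))) \<noteq> 0"
        proof
          assume "det (hankel d (\<lambda>m. lin_app (\<lambda>i. \<tau> i 0)
            (monom 1 m * hfac q (param_poly n x) j (- j)))) = 0"
          then have "det (hankel d (h d j x)) = 0"
            by (rule det_hankel_0_scale) (rule scale[OF moment])
          then show False using nz by blast
        qed
      qed
    qed
  qed
  ultimately show ?thesis by (intro exI[of _ E]) simp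
qed

end
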